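(* Let $X,Y,Z$ be topological spaces and let $f:X\to Y$ and $g:Y\to Z$ be continuous maps. Then $\mathrm{cat}(g\circ f)\le\min\{\mathrm{cat}(f),\mathrm{cat}(g)\}$.
   Context: A continuous map is null-homotopic if it is (freely) homotopic to a constant map. The category $\mathrm{cat}(f)$ of a continuous map $f:X\to Y$ is the least positive integer $n$ such that $X$ is a union of open subsets $U_1,\dots,U_n$ with each restriction $f_{|U_i}:U_i\to Y$ null-homotopic, and $\infty$ if no such integer exists. *)

theory Defs
  imports "HOL-Analysis.Analysis"
begin

text \<open>
  The value \<open>c\<close> is not required to lie in \<open>topspace Y\<close>: this is automatic when \<open>topspace X\<close> is
  nonempty, and otherwise it makes the empty map (vacuously constant) null-homotopic for every
  \<open>Y\<close>, including the empty space. Compare \<open>contractible_space_def\<close>.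
\<close>

definition null_homotopic :: "'a topology \<Rightarrow> 'b topology \<Rightarrow> ('a \<Rightarrow> 'b) \<Rightarrow> bool" where
  "null_homotopic X Y f \<longleftrightarrow> (\<exists>c. homotopic_with (\<lambda>_. True) X Y f (\<lambda>_. c))"

definition null_homotopic_cover ::
    "'a topology \<Rightarrow> 'b topology \<Rightarrow> ('a \<Rightarrow> 'b) \<Rightarrow> nat \<Rightarrow> (nat \<Rightarrow> 'a set) \<Rightarrow> bool" where
  "null_homotopic_cover X Y f n U \<longleftrightarrow>
     topspace X = (\<Union>i\<in>{1..n}. U i) \<and>
     (\<forall>i\<in>{1..n}. openin X (U i) \<and> null_homotopic (subtopology X (U i)) Y f)"

definition map_cat :: "'a topology \<Rightarrow> 'b topology \<Rightarrow> ('a \<Rightarrow> 'b) \<Rightarrow> enat" where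
  "map_cat X Y f =
     (if \<exists>n\<ge>1. \<exists>U. null_homotopic_cover X Y f n U
      then enat (LEAST n. n \<ge> 1 \<and> (\<exists>U. null_homotopic_cover X Y f n U))
      else \<infinity>)"

end

theory Submission
  imports Defs
begin

text \<open>Null-homotopy survives composition on either side: a homotopy from \<open>f\<close> to a
  constant \<open>c\<close> can be followed by \<open>g\<close>, ending at the constant
  \<open>g c\<close>, and a homotopy from \<open>g\<close> to a constant can be precomposed with
  \<open>f\<close>, ending at the same constant. Hence a cover of \<open>X\<close> suited to
  \<open>f\<close> is already suited to \<open>g \<circ> f\<close>, and a cover of \<open>Y\<close>
  suited to \<open>g\<close> pulls back along \<open>f\<close> to one of \<open>X\<close> suited to
  \<open>g \<circ> f\<close>. Both constructions (\<open>null_homotopic_cover_compose_left\<close>,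
  \<open>null_homotopic_cover_compose_right\<close>) keep the number of sets, so each n admissible
  for \<open>f\<close> or for \<open>g\<close> is admissible for \<open>g \<circ> f\<close>, whose
  least admissible n can only be smaller or equal.\<close>

lemma null_homotopic_compose_left:
  assumes "null_homotopic X Y f" "continuous_map Y Z g"
  shows "null_homotopic X Z (g \<circ> f)"
proof -
  obtain c where "homotopic_with (\<lambda>_. True) X Y f (\<lambda>_. c)"
    using assms(1) unfolding null_homotopic_def by blast
  then have "homotopic_with (\<lambda>_. True) X Z (g \<circ> f) (g \<circ> (\<lambda>_. c))"
    by (rule homotopic_with_compose_continuous_map_left) (use assms(2) in auto)
  then show ?thesis
    unfolding null_homotopic_def by (auto simp: o_def)
qed

lemma null_homotopic_compose_right:
  assumes "null_homotopic Y Z g" "continuous_map X Y f"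
  shows "null_homotopic X Z (g \<circ> f)"
proof -
  obtain c where "homotopic_with (\<lambda>_. True) Y Z g (\<lambda>_. c)"
    using assms(1) unfolding null_homotopic_def by blast
  then have "homotopic_with (\<lambda>_. True) X Z (g \<circ> f) ((\<lambda>_. c) \<circ> f)"
    by (rule homotopic_with_compose_continuous_map_right) (use assms(2) in auto)
  then show ?thesis
    unfolding null_homotopic_def by (auto simp: o_def)
qed

lemma null_homotopic_cover_compose_left:
  assumes "null_homotopic_cover X Y f n U" "continuous_map Y Z g"
  shows "null_homotopic_cover X Z (g \<circ> f) n U"
  using assms unfolding null_homotopic_cover_def by (auto intro: null_homotopic_compose_left)

text \<open>On the preimage of \<open>U i\<close>, the composite factors through the restriction of
  \<open>g\<close> to \<open>U i\<close>, which is null-homotopic. Preimages are cut down to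
  \<open>topspace X\<close> because \<open>f\<close> is unconstrained outside it.\<close>

lemma null_homotopic_cover_compose_right:
  assumes U: "null_homotopic_cover Y Z g n U" and f: "continuous_map X Y f"
  shows "null_homotopic_cover X Z (g \<circ> f) n (\<lambda>i. {x \<in> topspace X. f x \<in> U i})"
  unfolding null_homotopic_cover_def
proof (intro conjI ballI)
  show "topspace X = (\<Union>i\<in>{1..n}. {x \<in> topspace X. f x \<in> U i})"
    using U continuous_map_funspace[OF f]
    unfolding null_homotopic_cover_def by fastforce
next
  fix i assume i: "i \<in> {1..n}"
  let ?V = "{x \<in> topspace X. f x \<in> U i}"
  show "openin X ?V"
    using U i f unfolding null_homotopic_cover_def by (simp add: openin_continuous_map_preimage)
  \<comment> \<open>The codomain must shrink to \<open>U i\<close> as well, since \<open>g\<close>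
    is known to be null-homotopic only there.\<close>
  have "continuous_map (subtopology X ?V) (subtopology Y (U i)) f"
    using f by (auto simp: continuous_map_in_subtopology continuous_map_from_subtopology)
  then show "null_homotopic (subtopology X ?V) Z (g \<circ> f)"
    using U i unfolding null_homotopic_cover_def by (auto intro: null_homotopic_compose_right)
qed

lemma map_cat_le:
  assumes "n \<ge> 1" "null_homotopic_cover X Y f n U"
  shows "map_cat X Y f \<le> enat n"
proof -
  have ex: "\<exists>n\<ge>1. \<exists>U. null_homotopic_cover X Y f n U"
    using assms by blast
  have "(LEAST n. n \<ge> 1 \<and> (\<exists>U. null_homotopic_cover X Y f n U)) \<le> n"
    by (rule Least_le) (use assms in blast)
  with ex show ?thesis
    unfolding map_cat_def by simp
qed

text \<open>By well-ordering of the naturals a finite category is attained, so it comes with an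
  optimal cover of exactly that many sets.\<close>

lemma map_cat_cases:
  obtains "map_cat X Y f = \<infinity>"
  | n U where "map_cat X Y f = enat n" "n \<ge> 1" "null_homotopic_cover X Y f n U"
proof (cases "\<exists>n\<ge>1. \<exists>U. null_homotopic_cover X Y f n U")
  case True
  let ?n = "LEAST n. n \<ge> 1 \<and> (\<exists>U. null_homotopic_cover X Y f n U)"
  have "?n \<ge> 1 \<and> (\<exists>U. null_homotopic_cover X Y f ?n U)"
    by (rule LeastI_ex) (use True in blast)
  moreover have "map_cat X Y f = enat ?n"
    using True unfolding map_cat_def by (rule if_P)
  ultimately show ?thesis
    using that(2) by blast
next
  case False
  then have "map_cat X Y f = \<infinity>"
    unfolding map_cat_def by (rule if_not_P)
  then show ?thesis
    by (rule that(1))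
qed

theorem mainTheorem9:
  fixes X :: "'a topology" and Y :: "'b topology" and Z :: "'c topology"
    and f :: "'a \<Rightarrow> 'b" and g :: "'b \<Rightarrow> 'c"
  assumes "continuous_map X Y f" and "continuous_map Y Z g"
  shows "map_cat X Z (g \<circ> f) \<le> min (map_cat X Y f) (map_cat Y Z g)"
proof (rule min.boundedI)
  show "map_cat X Z (g \<circ> f) \<le> map_cat X Y f"
  proof (cases rule: map_cat_cases[of X Y f])
    \<comment> \<open>Only a finite bound has content; the infinite case is trivial. An optimal
      cover for \<open>f\<close> is reused unchanged.\<close>
    case (2 n U)
    show ?thesis
      unfolding 2(1) using 2(2) null_homotopic_cover_compose_left[OF 2(3) assms(2)]
      by (rule map_cat_le)
  qed simp
  show "map_cat X Z (g \<circ> f) \<le> map_cat Y Z g"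
  proof (cases rule: map_cat_cases[of Y Z g])
    \<comment> \<open>Here an optimal cover for \<open>g\<close> is pulled back along
      \<open>f\<close>, again with n sets.\<close>
    case (2 n U)
    show ?thesis
      unfolding 2(1) using 2(2) null_homotopic_cover_compose_right[OF 2(3) assms(1)]
      by (rule map_cat_le)
  qed simp
qed

end
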